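(* Let $\Gamma$ be a sequent and $A$ a term. If the inference $\Gamma \vdash A$ has a proof in the system $\mathbb{T}$, then it has a proof in the system $\mathbb{T}$ that does not use the cut rule.
   Context: Fix a countable set $\Phi$ of atomic propositions. Terms are generated from the elements of $\Phi$ and a constant $\mathbb{1}$ using a binary connective $\otimes$ (with parentheses). A sequent is a (possibly empty, not necessarily finite) multiset of terms; a comma denotes multiset union. An inference is an expression $\Gamma \vdash A$ with $\Gamma$ a sequent and $A$ a term. The system $\mathbb{T}$ has the following deduction rules. (Id) $P \vdash P$ for every atomic proposition $P\in\Phi$. (Cut) From $\Gamma \vdash B$ and $\Delta, B \vdash A$ deduce $\Delta,\Gamma \vdash A$, for any term $B$. (L-$\mathbb{1}$) From $\Gamma \vdash A$ deduce $\Gamma, \mathbb{1} \vdash A$. (R-$\mathbb{1}$) $\vdash \mathbb{1}$. (L-$\otimes$) From $A, B, \Gamma \vdash C$ deduce $A\otimes B, \Gamma \vdash C$. (R-$\otimes$) From $\Gamma \vdash A$ and $\Delta \vdash B$ deduce $\Gamma,\Delta \vdash A\otimes B$. (Exchange) Antecedent terms may be reordered arbitrarily (automatic when antecedents are multisets). A proof of an inference is a finite tree of rule applications with that inference as conclusion. *)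

theory Defs
  imports Main "HOL-Library.Countable_Set" "HOL-Library.Extended_Nat"
    "HOL-Library.Function_Algebras"
begin

datatype (atoms: 'a) tm =
    Atom 'a
  | One  (\<open>\<one>\<close>)
  | Tensor "'a tm" "'a tm"  (infixr \<open>\<otimes>\<close> 70)

definition terms :: "'a set \<Rightarrow> 'a tm set" where
  "terms \<Phi> = {t. atoms t \<subseteq> \<Phi>}"

text \<open>
  Sequents need not be finite, so the library type of (finite) multisets does not fit: a sequent
  is a multiplicity function, where \<open>\<infinity>\<close> stands for infinitely many copies. Multiset
  union is pointwise addition, and the empty multiset is the constant function \<open>0\<close>.
\<close>

type_synonym 'a sequent = "'a tm \<Rightarrow> enat"

definition single :: "'a tm \<Rightarrow> 'a sequent"  (\<open>\<lbrace>_\<rbrace>\<close>) where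
  "\<lbrace>A\<rbrace> = (\<lambda>B. if B = A then 1 else 0)"

definition sequents :: "'a set \<Rightarrow> 'a sequent set" where
  "sequents \<Phi> = {\<Gamma>. \<forall>t. \<Gamma> t \<noteq> 0 \<longrightarrow> t \<in> terms \<Phi>}"

datatype 'a inference = Inference "'a sequent" "'a tm"  (infix \<open>\<turnstile>\<close> 50)

definition inferences :: "'a set \<Rightarrow> 'a inference set" where
  "inferences \<Phi> = {\<Gamma> \<turnstile> A | \<Gamma> A. \<Gamma> \<in> sequents \<Phi> \<and> A \<in> terms \<Phi>}"

datatype rule = Id | Cut | L_One | R_One | L_Tensor | R_Tensor

text \<open>
  \<open>rule_app \<Phi> r Is I\<close>: rule \<open>r\<close> deduces \<open>I\<close> from the list of premises
  \<open>Is\<close>. There is no exchange rule, because antecedents are multisets.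
\<close>

inductive rule_app :: "'a set \<Rightarrow> rule \<Rightarrow> 'a inference list \<Rightarrow> 'a inference \<Rightarrow> bool"
  for \<Phi> :: "'a set" where
  "P \<in> \<Phi> \<Longrightarrow> rule_app \<Phi> Id [] (\<lbrace>Atom P\<rbrace> \<turnstile> Atom P)"
| "rule_app \<Phi> Cut [\<Gamma> \<turnstile> B, \<Delta> + \<lbrace>B\<rbrace> \<turnstile> A] (\<Delta> + \<Gamma> \<turnstile> A)"
| "rule_app \<Phi> L_One [\<Gamma> \<turnstile> A] (\<Gamma> + \<lbrace>\<one>\<rbrace> \<turnstile> A)"
| "rule_app \<Phi> R_One [] (0 \<turnstile> \<one>)"
| "rule_app \<Phi> L_Tensor [\<lbrace>A\<rbrace> + \<lbrace>B\<rbrace> + \<Gamma> \<turnstile> C] (\<lbrace>A \<otimes> B\<rbrace> + \<Gamma> \<turnstile> C)"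
| "rule_app \<Phi> R_Tensor [\<Gamma> \<turnstile> A, \<Delta> \<turnstile> B] (\<Gamma> + \<Delta> \<turnstile> A \<otimes> B)"

datatype 'a proof_tree =
  Node (root_rule: rule) (conclusion: "'a inference") (subproofs: "'a proof_tree list")

text \<open>
  Every inference occurring in a proof is over \<open>\<Phi>\<close>; in particular so is every cut term.
\<close>

primrec valid_proof :: "'a set \<Rightarrow> 'a proof_tree \<Rightarrow> bool" where
  "valid_proof \<Phi> (Node r I ps) \<longleftrightarrow>
     I \<in> inferences \<Phi> \<and> rule_app \<Phi> r (map conclusion ps) I \<and> list_all (valid_proof \<Phi>) ps"

primrec rules_used :: "'a proof_tree \<Rightarrow> rule set" where
  "rules_used (Node r I ps) = insert r (\<Union> (set (map rules_used ps)))"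

definition is_proof_of :: "'a set \<Rightarrow> 'a proof_tree \<Rightarrow> 'a inference \<Rightarrow> bool" where
  "is_proof_of \<Phi> p I \<longleftrightarrow> valid_proof \<Phi> p \<and> conclusion p = I"

end

theory Submission
  imports Defs "HOL-Library.Multiset"
begin

text \<open>
  Provability has a complete invariant: \<open>\<Gamma> \<turnstile> A\<close> is provable iff \<open>\<Gamma>\<close> is finite and
  contains every atomic proposition, counted through the tensors, as often as \<open>A\<close> does. Every
  rule, including Cut, preserves this balance. Conversely, a balanced inference has a cut-free proof:
  right rules build \<open>A\<close> from the multiset of its atoms, and left rules then reassemble
  the terms of \<open>\<Gamma>\<close> from these atoms.
\<close>

primrec atoms_mset :: "'a tm \<Rightarrow> 'a multiset" where
  "atoms_mset (Atom P) = {#P#}"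
| "atoms_mset \<one> = {#}"
| "atoms_mset (A \<otimes> B) = atoms_mset A + atoms_mset B"

abbreviation atom_terms :: "'a tm \<Rightarrow> 'a tm multiset" where
  "atom_terms A \<equiv> image_mset Atom (atoms_mset A)"

text \<open>Embeds the finite multisets into the sequents. Provable antecedents turn out to lie in
  its range, so multiset reasoning applies to them.\<close>

definition seq_of :: "'a tm multiset \<Rightarrow> 'a sequent" where
  "seq_of M = (\<lambda>t. enat (count M t))"

lemma seq_of_empty: "seq_of {#} = 0"
  by (simp add: seq_of_def fun_eq_iff zero_enat_def)

lemma seq_of_plus: "seq_of (M + N) = seq_of M + seq_of N"
  by (simp add: seq_of_def fun_eq_iff)

lemma seq_of_single: "seq_of {#A#} = \<lbrace>A\<rbrace>"
  by (simp add: seq_of_def single_def fun_eq_iff zero_enat_def one_enat_def)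

lemma seq_of_in_sequents: "seq_of M \<in> sequents \<Phi> \<longleftrightarrow> set_mset M \<subseteq> terms \<Phi>"
  by (auto simp: seq_of_def sequents_def zero_enat_def)

text \<open>Addition on \<open>enat\<close> does not cancel at \<open>\<infinity>\<close>, but the
  finite total forces both summands to be finite. This recovers the context from a premise of
  \<open>Cut\<close> or \<open>L_Tensor\<close>.\<close>

lemma plus_seq_of_eq:
  assumes "\<Gamma> + seq_of K = seq_of N"
  obtains M where "\<Gamma> = seq_of M" "N = M + K"
proof -
  have eq: "\<Gamma> t + enat (count K t) = enat (count N t)" for t
    using fun_cong[OF assms, of t] by (simp add: seq_of_def)
  have \<Gamma>: "\<Gamma> t = enat (count (N - K) t)" for t
    using eq[of t] by (cases "\<Gamma> t") auto
  have "count K t \<le> count N t" for t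
    using eq[of t] by (cases "\<Gamma> t") auto
  then have "N = (N - K) + K"
    by (simp add: subseteq_mset_def)
  moreover have "\<Gamma> = seq_of (N - K)"
    using \<Gamma> by (simp add: seq_of_def fun_eq_iff)
  ultimately show thesis using that by blast
qed

definition balanced :: "'a inference \<Rightarrow> bool" where
  "balanced I \<longleftrightarrow> (\<exists>M A. I = (seq_of M \<turnstile> A) \<and> (\<Sum>B\<in>#M. atoms_mset B) = atoms_mset A)"

text \<open>In \<open>Cut\<close>, the atoms that \<open>B\<close> contributes to the second premise
  are those of \<open>\<Gamma>\<close> by the first, so the replacement keeps the count.
  \<open>L_One\<close> adds no atoms, \<open>L_Tensor\<close> regroups them, and
  \<open>R_Tensor\<close> adds two balances.\<close>

lemma balanced_rule_app:
  assumes "rule_app \<Phi> r Is I" and "\<forall>J\<in>set Is. balanced J"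
  shows "balanced I"
  using assms
proof (cases rule: rule_app.cases)
  case (1 P)
  then show ?thesis
    unfolding balanced_def by (intro exI[of _ "{#Atom P#}"]) (simp add: seq_of_single)
next
  case (2 \<Gamma> B \<Delta> A)
  obtain M N where M: "\<Gamma> = seq_of M" "(\<Sum>B\<in>#M. atoms_mset B) = atoms_mset B"
    and N: "\<Delta> + seq_of {#B#} = seq_of N" "(\<Sum>B\<in>#N. atoms_mset B) = atoms_mset A"
    using 2 assms(2) by (auto simp: balanced_def seq_of_single)
  from N(1) obtain K where "\<Delta> = seq_of K" "N = K + {#B#}"
    by (rule plus_seq_of_eq)
  with 2 M N(2) show ?thesis
    unfolding balanced_def by (intro exI[of _ "K + M"]) (simp add: seq_of_plus add.commute)
next
  case (3 \<Gamma> A)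
  then obtain M where "\<Gamma> = seq_of M" "(\<Sum>B\<in>#M. atoms_mset B) = atoms_mset A"
    using assms(2) by (auto simp: balanced_def)
  with 3 show ?thesis
    \<comment> \<open>The simplifier turns \<open>M + {#\<one>#}\<close> into an
      \<open>add_mset\<close>, so \<open>seq_of_plus\<close> is normalised in the same way.\<close>
    unfolding balanced_def
    by (intro exI[of _ "M + {#\<one>#}"]) (simp add: seq_of_plus[of _ "{#\<one>#}", simplified] seq_of_single)
next
  case 4
  then show ?thesis
    unfolding balanced_def by (intro exI[of _ "{#}"]) (simp add: seq_of_empty)
next
  case (5 A B \<Gamma> C)
  obtain N where N: "\<Gamma> + seq_of ({#A#} + {#B#}) = seq_of N"
      "(\<Sum>B\<in>#N. atoms_mset B) = atoms_mset C"
    using 5 assms(2) unfolding seq_of_plus seq_of_single by (auto simp: balanced_def add.commute)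
  from N(1) obtain K where "\<Gamma> = seq_of K" "N = K + ({#A#} + {#B#})"
    by (rule plus_seq_of_eq)
  with 5 N(2) show ?thesis
    unfolding balanced_def
    by (intro exI[of _ "{#A \<otimes> B#} + K"])
      (simp add: seq_of_plus[of "{#A \<otimes> B#}", simplified] seq_of_single ac_simps)
next
  case (6 \<Gamma> A \<Delta> B)
  then obtain M N where "\<Gamma> = seq_of M" "(\<Sum>B\<in>#M. atoms_mset B) = atoms_mset A"
    and "\<Delta> = seq_of N" "(\<Sum>B\<in>#N. atoms_mset B) = atoms_mset B"
    using assms(2) by (auto simp: balanced_def)
  with 6 show ?thesis
    unfolding balanced_def by (intro exI[of _ "M + N"]) (simp add: seq_of_plus)
qed

lemma balanced_conclusion: "valid_proof \<Phi> p \<Longrightarrow> balanced (conclusion p)"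
proof (induction p)
  case (Node r I ps)
  then show ?case
    using balanced_rule_app[of \<Phi> r "map conclusion ps" I] by (auto simp: list_all_iff)
qed

definition cut_free :: "'a set \<Rightarrow> 'a tm multiset \<Rightarrow> 'a tm \<Rightarrow> bool" where
  "cut_free \<Phi> M A \<longleftrightarrow> (\<exists>p. is_proof_of \<Phi> p (seq_of M \<turnstile> A) \<and> Cut \<notin> rules_used p)"

lemma cut_free_in_terms:
  assumes "cut_free \<Phi> M A"
  shows "set_mset M \<subseteq> terms \<Phi>" and "A \<in> terms \<Phi>"
proof -
  obtain p where "valid_proof \<Phi> p" "conclusion p = (seq_of M \<turnstile> A)"
    using assms by (auto simp: cut_free_def is_proof_of_def)
  then have "(seq_of M \<turnstile> A) \<in> inferences \<Phi>"
    by (cases p) auto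
  then show "set_mset M \<subseteq> terms \<Phi>" "A \<in> terms \<Phi>"
    by (auto simp: inferences_def seq_of_in_sequents)
qed

text \<open>Chosen proofs of the premises become the subtrees of a new root. Each rule except
  \<open>Cut\<close> gets its closure property as an instance.\<close>

lemma cut_free_rule_app:
  assumes "rule_app \<Phi> r (map (\<lambda>(N, B). seq_of N \<turnstile> B) Js) (seq_of M \<turnstile> A)"
    and "r \<noteq> Cut" and "\<forall>(N, B)\<in>set Js. cut_free \<Phi> N B"
    and "set_mset M \<subseteq> terms \<Phi>" and "A \<in> terms \<Phi>"
  shows "cut_free \<Phi> M A"
proof -
  have "\<forall>J\<in>set Js. \<exists>p. is_proof_of \<Phi> p (seq_of (fst J) \<turnstile> snd J) \<and> Cut \<notin> rules_used p"
    using assms(3) by (auto simp: cut_free_def)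
  then obtain f where f: "\<forall>J\<in>set Js. is_proof_of \<Phi> (f J) (seq_of (fst J) \<turnstile> snd J) \<and> Cut \<notin> rules_used (f J)"
    by metis
  have "map conclusion (map f Js) = map (\<lambda>(N, B). seq_of N \<turnstile> B) Js"
    using f by (auto simp: is_proof_of_def)
  then have "is_proof_of \<Phi> (Node r (seq_of M \<turnstile> A) (map f Js)) (seq_of M \<turnstile> A)"
    using f assms
    by (auto simp: is_proof_of_def list_all_iff inferences_def seq_of_in_sequents
        simp del: map_map)
  moreover have "Cut \<notin> rules_used (Node r (seq_of M \<turnstile> A) (map f Js))"
    using f assms(2) by auto
  ultimately show ?thesis
    unfolding cut_free_def by blast
qed

lemma cut_free_Id: "P \<in> \<Phi> \<Longrightarrow> cut_free \<Phi> {#Atom P#} (Atom P)"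
  by (rule cut_free_rule_app[where r = Id and Js = "[]"])
    (auto simp: seq_of_single terms_def intro: rule_app.intros)

lemma cut_free_R_One: "cut_free \<Phi> {#} \<one>"
  by (rule cut_free_rule_app[where r = R_One and Js = "[]"])
    (auto simp: seq_of_empty terms_def intro: rule_app.intros)

lemma cut_free_R_Tensor:
  assumes "cut_free \<Phi> M A" and "cut_free \<Phi> N B"
  shows "cut_free \<Phi> (M + N) (A \<otimes> B)"
  using assms assms[THEN cut_free_in_terms(1)] assms[THEN cut_free_in_terms(2)]
  by (intro cut_free_rule_app[where r = R_Tensor and Js = "[(M, A), (N, B)]"])
    (auto simp: seq_of_plus terms_def intro: rule_app.intros)

lemma cut_free_L_One:
  assumes "cut_free \<Phi> M A"
  shows "cut_free \<Phi> (M + {#\<one>#}) A"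
  by (rule cut_free_rule_app[where r = L_One and Js = "[(M, A)]"])
    (use assms cut_free_in_terms[OF assms] in
      \<open>auto simp: seq_of_plus[of _ "{#\<one>#}", simplified] seq_of_single terms_def
        intro: rule_app.intros\<close>)

lemma cut_free_L_Tensor:
  assumes "cut_free \<Phi> ({#A#} + {#B#} + M) C"
  shows "cut_free \<Phi> ({#A \<otimes> B#} + M) C"
proof (rule cut_free_rule_app[where r = L_Tensor and Js = "[({#A#} + {#B#} + M, C)]"])
  show "rule_app \<Phi> L_Tensor (map (\<lambda>(N, B). seq_of N \<turnstile> B) [({#A#} + {#B#} + M, C)])
      (seq_of ({#A \<otimes> B#} + M) \<turnstile> C)"
    unfolding seq_of_plus seq_of_single list.map case_prod_conv by (rule rule_app.intros)
qed (use assms cut_free_in_terms[OF assms] in \<open>auto simp: terms_def\<close>)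

text \<open>\<open>Id\<close>, \<open>R_One\<close> and \<open>R_Tensor\<close> match the three
  constructors of \<open>A\<close>.\<close>

lemma cut_free_atom_terms: "A \<in> terms \<Phi> \<Longrightarrow> cut_free \<Phi> (atom_terms A) A"
  by (induction A)
    (auto simp: terms_def intro: cut_free_Id cut_free_R_One cut_free_R_Tensor)

text \<open>The context is generalised because the factors of a tensor are reassembled in turn: the
  atoms of \<open>C\<close> sit in the context while \<open>B\<close> is rebuilt, then
  \<open>B\<close> does while \<open>C\<close> is rebuilt.\<close>

lemma cut_free_fold_term:
  assumes "cut_free \<Phi> (atom_terms B + M) A"
  shows "cut_free \<Phi> ({#B#} + M) A"
  using assms
proof (induction B arbitrary: M)
  case (Atom P)
  then show ?case by simp
next
  case One
  then show ?case using cut_free_L_One[of \<Phi> M A] by simp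
next
  case (Tensor B C)
  have "cut_free \<Phi> (atom_terms B + (atom_terms C + M)) A"
    using Tensor.prems by (simp add: ac_simps)
  then have "cut_free \<Phi> ({#B#} + (atom_terms C + M)) A"
    by (rule Tensor.IH)
  then have "cut_free \<Phi> (atom_terms C + ({#B#} + M)) A"
    by (simp only: add.left_commute)
  then have "cut_free \<Phi> ({#C#} + ({#B#} + M)) A"
    by (rule Tensor.IH)
  then have "cut_free \<Phi> ({#B#} + {#C#} + M) A"
    by (simp add: add_mset_commute)
  then show ?case by (rule cut_free_L_Tensor)
qed

lemma cut_free_fold_terms:
  assumes "cut_free \<Phi> ((\<Sum>B\<in>#M. atom_terms B) + N) A"
  shows "cut_free \<Phi> (M + N) A"
  using assms
proof (induction M arbitrary: N)
  case empty
  then show ?case by simp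
next
  case (add B M)
  \<comment> \<open>The atoms of the new term \<open>B\<close> wait in the context until the
    induction hypothesis has reassembled \<open>M\<close>.\<close>
  have "cut_free \<Phi> ((\<Sum>B\<in>#M. atom_terms B) + (atom_terms B + N)) A"
    using add.prems by (simp add: ac_simps)
  then have "cut_free \<Phi> (atom_terms B + (M + N)) A"
    using add.IH by (metis add.left_commute)
  then show ?case
    using cut_free_fold_term by fastforce
qed

text \<open>By balance, the atoms from which \<open>A\<close> is built are those of
  \<open>M\<close>, so folding them into the terms of \<open>M\<close> stays within one
  proof.\<close>

lemma balanced_imp_cut_free:
  assumes "(\<Sum>B\<in>#M. atoms_mset B) = atoms_mset A" and "A \<in> terms \<Phi>"
  shows "cut_free \<Phi> M A"
proof -
  have "(\<Sum>B\<in>#M. atom_terms B) = image_mset Atom (\<Sum>B\<in>#M. atoms_mset B)"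
    by (induction M) auto
  then have "cut_free \<Phi> ((\<Sum>B\<in>#M. atom_terms B) + {#}) A"
    using assms cut_free_atom_terms by simp
  then show ?thesis
    using cut_free_fold_terms by fastforce
qed

theorem theorem7:
  fixes \<Phi> :: "'a set" and \<Gamma> :: "'a sequent" and A :: "'a tm"
  assumes "countable \<Phi>"
    and "\<Gamma> \<in> sequents \<Phi>" and "A \<in> terms \<Phi>"
    and "\<exists>p. is_proof_of \<Phi> p (\<Gamma> \<turnstile> A)"
  shows "\<exists>p. is_proof_of \<Phi> p (\<Gamma> \<turnstile> A) \<and> Cut \<notin> rules_used p"
proof -
  \<comment> \<open>Only the balance of its conclusion is taken from the given proof; the cut-free
    proof is built afresh.\<close>
  have "balanced (\<Gamma> \<turnstile> A)"
    using assms(4) balanced_conclusion by (metis is_proof_of_def)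
  then obtain M where "\<Gamma> = seq_of M" "(\<Sum>B\<in>#M. atoms_mset B) = atoms_mset A"
    by (auto simp: balanced_def)
  then show ?thesis
    using balanced_imp_cut_free[OF _ assms(3)] by (auto simp: cut_free_def)
qed

end
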